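(* (ZFC) There is no strict $J_{\omega^\omega}$-ultrafilter; that is, there is no ultrafilter $u$ on $\omega$ which is a $J_{\omega^\omega}$-ultrafilter but is not a $J_\beta$-ultrafilter for any ordinal $\beta<\omega^\omega$.
   Context: For a countable ordinal $\alpha$, an ultrafilter $u$ on $\omega$ is a $J_\alpha$-ultrafilter if for every function $f:\omega\to\omega_1$ there is $U\in u$ such that the order type of $f[U]$ (as a subset of $\omega_1$) is less than $\alpha$. *)

theory Defs
  imports "HOL-Library.Multiset_Order"
begin

unbundle cardinal_syntax

text \<open>Ordinals are represented by well-orders, compared by \<open><o\<close>.\<close>

definition omega1 :: "nat set rel" where
  "omega1 = cardSuc natLeq"

text \<open>
  Cantor's description of the ordinal power \<open>\<omega>\<^sup>\<omega>\<close>: finitely supported functions from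
  \<open>\<omega>\<close> to \<open>\<omega>\<close>, compared at the largest argument at which they differ.  Such a function
  \<open>c\<close> stands for the Cantor normal form whose coefficient at \<open>\<omega>\<^sup>k\<close> is \<open>c k\<close>.
\<close>

definition omega_omega :: "(nat \<Rightarrow> nat) rel" where
  "omega_omega =
     {(c, d). finite {k. c k \<noteq> 0} \<and> finite {k. d k \<noteq> 0} \<and>
              (c = d \<or> (\<exists>m. c m < d m \<and> (\<forall>k>m. c k = d k)))}"

definition is_ultrafilter :: "'a filter \<Rightarrow> bool" where
  "is_ultrafilter u \<longleftrightarrow>
     u \<noteq> bot \<and> (\<forall>A. eventually (\<lambda>x. x \<in> A) u \<or> eventually (\<lambda>x. x \<in> - A) u)"

definition J_ultrafilter :: "'a rel \<Rightarrow> nat filter \<Rightarrow> bool" where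
  "J_ultrafilter \<alpha> u \<longleftrightarrow>
     is_ultrafilter u \<and>
     (\<forall>f. range f \<subseteq> Field omega1 \<longrightarrow>
        (\<exists>U. eventually (\<lambda>n. n \<in> U) u \<and> Restr omega1 (f ` U) <o \<alpha>))"

lemma Well_order_omega1: "Well_order omega1"
  unfolding omega1_def by (intro card_order_on_well_order_on cardSuc_Card_order natLeq_Card_order)

lemma Field_omega_omega: "Field omega_omega = {c. finite {k. c k \<noteq> 0}}"
  unfolding omega_omega_def Field_def by auto

lemma Well_order_omega_omega: "Well_order omega_omega"
proof -
  have refl: "Refl omega_omega"
    unfolding refl_on_def Field_omega_omega by (auto simp: omega_omega_def)
  have less: "Abs_multiset c < Abs_multiset d"
    if "(c, d) \<in> omega_omega - Id" for c d
  proof -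
    from that have fin: "finite {k. 0 < c k}" "finite {k. 0 < d k}"
      and "\<exists>m. c m < d m \<and> (\<forall>k>m. c k = d k)"
      by (auto simp: omega_omega_def)
    then obtain m where m: "c m < d m" "\<forall>k>m. c k = d k" by blast
    have "\<exists>x>y. c x < d x" if "d y < c y" for y
      using m that by (metis not_less_iff_gr_or_eq)
    then show ?thesis
      using fin m(1) unfolding less_multiset\<^sub>H\<^sub>O
      by (auto simp: count_Abs_multiset dest!: arg_cong[where f = count])
  qed
  have "omega_omega - Id \<subseteq> inv_image {(M, N). M < N} Abs_multiset"
    using less by (auto simp: inv_image_def)
  then have wf: "wf (omega_omega - Id)"
    using wf_subset[OF wf_inv_image[OF wf]] by blast
  have trans: "trans omega_omega"
  proof (rule transI)
    fix c d e assume cd: "(c, d) \<in> omega_omega" and de: "(d, e) \<in> omega_omega"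
    show "(c, e) \<in> omega_omega"
    proof (cases "c = d \<or> d = e")
      case True then show ?thesis using cd de by auto
    next
      case False
      with cd de obtain m n where m: "c m < d m" "\<forall>k>m. c k = d k"
        and n: "d n < e n" "\<forall>k>n. d k = e k"
        by (auto simp: omega_omega_def)
      have "c (max m n) < e (max m n) \<and> (\<forall>k>max m n. c k = e k)"
        using m n by (cases m n rule: linorder_cases) (auto simp: max_def)
      then show ?thesis using cd de unfolding omega_omega_def by blast
    qed
  qed
  have antisym: "antisym omega_omega"
  proof (rule antisymI, rule ccontr)
    fix c d assume "(c, d) \<in> omega_omega" "(d, c) \<in> omega_omega" "c \<noteq> d"
    then have "Abs_multiset c < Abs_multiset d" "Abs_multiset d < Abs_multiset c"
      using less by auto
    then show False by (rule less_asym)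
  qed
  have total: "Total omega_omega"
    unfolding total_on_def Field_omega_omega
  proof (intro ballI impI)
    fix c d :: "nat \<Rightarrow> nat"
    assume "c \<in> {c. finite {k. c k \<noteq> 0}}" "d \<in> {c. finite {k. c k \<noteq> 0}}" and ne: "c \<noteq> d"
    then have fin: "finite {k. c k \<noteq> 0}" "finite {k. d k \<noteq> 0}" by auto
    let ?D = "{k. c k \<noteq> d k}"
    have D: "finite ?D"
      by (rule finite_subset[of _ "{k. c k \<noteq> 0} \<union> {k. d k \<noteq> 0}"]) (use fin in auto)
    have "?D \<noteq> {}" using ne by auto
    then have 1: "Max ?D \<in> ?D" using D by (rule Max_in[rotated])
    have 2: "c k = d k" if "Max ?D < k" for k
    proof (rule ccontr)
      assume "c k \<noteq> d k"
      then have "k \<le> Max ?D" using D by (intro Max_ge) simp_all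
      with that show False by simp
    qed
    obtain m where m: "c m \<noteq> d m" "\<forall>k>m. c k = d k"
      by (rule that[of "Max ?D"]) (use 1 in simp, intro allI impI, rule 2)
    then consider "c m < d m" | "d m < c m" by linarith
    then show "(c, d) \<in> omega_omega \<or> (d, c) \<in> omega_omega"
    proof cases
      case 1 then show ?thesis using fin m unfolding omega_omega_def by blast
    next
      case 2
      moreover have "\<forall>k>m. d k = c k" using m by simp
      ultimately show ?thesis using fin unfolding omega_omega_def by blast
    qed
  qed
  show ?thesis
    unfolding well_order_on_def linear_order_on_def partial_order_on_def preorder_on_def
    using refl trans antisym total wf by (auto simp: Field_def)
qed

end

theory Submission
  imports Defs "HOL-Library.Ramsey" "HOL-Library.Countable_Set_Type"
begin

text \<open>
  For an ultrafilter \<open>u\<close> compare functions \<open>x, y : \<omega> \<rightarrow> \<omega>\<close> by \<open>x \<lless> y\<close> iff \<open>h(x) < y\<close> on a set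
  of \<open>u\<close>, for every \<open>h : \<omega> \<rightarrow> \<omega>\<close>; thus \<open>x\<close> lies in a lower sky of the ultrapower than \<open>y\<close>.

  If \<open>u\<close> is \<open>J_{\<omega>^\<omega>}\<close> but not \<open>J_{\<omega>^n}\<close>, take a witness \<open>f\<close> of the latter and write its
  values on a set of \<open>u\<close> in Cantor normal form, with the least possible number of coefficients.
  A coefficient bounded by a function of the higher ones could be merged into its predecessor,
  so by minimality each one lies in a higher sky than everything above it, and there is a
  \<open>\<lless>\<close>-chain of length \<open>n\<close>.  If this happens for every \<open>n\<close>, Ramsey's theorem gives an infinite
  monotone sequence of skies.  Using an initial part of it, of length varying with the argument,
  as Cantor coefficients (the smallest in front) yields a map into \<open>\<omega>^\<omega>\<close> that sends every set
  of \<open>u\<close> to a set containing copies of all \<open>\<omega>^n\<close>, which contradicts \<open>J_{\<omega>^\<omega>}\<close>.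
\<close>

section \<open>The strict order of Cantor normal forms\<close>

definition lex_less :: "(nat \<Rightarrow> nat) \<Rightarrow> (nat \<Rightarrow> nat) \<Rightarrow> bool" where
  "lex_less c d \<longleftrightarrow> (\<exists>m. c m < d m \<and> (\<forall>k>m. c k = d k))"

lemma lex_less_le_at:
  assumes "lex_less c d" "\<forall>k>n. c k = d k"
  shows "c n \<le> d n"
proof -
  obtain m where m: "c m < d m" "\<forall>k>m. c k = d k"
    using assms(1) unfolding lex_less_def by blast
  show ?thesis
  proof (rule ccontr)
    assume *: "\<not> c n \<le> d n"
    consider "m < n" | "m = n" | "n < m" by linarith
    then show False
    proof cases
      case 1
      then have "c n = d n" using m(2) by simp
      with * show False by simp
    next
      case 2
      with m(1) * show False by simp
    next
      case 3
      then have "c m = d m" using assms(2) by simp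
      with m(1) show False by simp
    qed
  qed
qed

lemma mem_omega_omega_iff:
  "(c, d) \<in> omega_omega \<longleftrightarrow>
     finite {k. c k \<noteq> 0} \<and> finite {k. d k \<noteq> 0} \<and> (c = d \<or> lex_less c d)"
  unfolding omega_omega_def lex_less_def by simp

lemma lex_less_irrefl: "\<not> lex_less c c"
  unfolding lex_less_def by simp

lemma finite_support_if_eq_0_above:
  assumes "\<forall>k\<ge>n. (c :: nat \<Rightarrow> nat) k = 0"
  shows "finite {k. c k \<noteq> 0}"
proof (rule finite_subset)
  show "{k. c k \<noteq> 0} \<subseteq> {..<n}" 
  proof
    fix k assume "k \<in> {k. c k \<noteq> 0}"
    then have "\<not> n \<le> k" using assms by auto
    then show "k \<in> {..<n}" by simp
  qed
qed simp

section \<open>Trees of finite height in \<open>\<omega>\<^sup>\<omega>\<close>\<close>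

text \<open>Witnesses a copy of \<omega>^n inside \<open>S\<close>: an \<omega>-sequence of blocks,
  each with a copy of the previous power. Comparing consecutive blocks suffices, as blocks are
  nonempty and \<open>lex_less\<close> is transitive.\<close>

primrec omega_tree :: "nat \<Rightarrow> (nat \<Rightarrow> nat) set \<Rightarrow> bool" where
  "omega_tree 0 S \<longleftrightarrow> S \<noteq> {}"
| "omega_tree (Suc n) S \<longleftrightarrow>
     (\<exists>A :: nat \<Rightarrow> (nat \<Rightarrow> nat) set. (\<forall>j. A j \<subseteq> S \<and> omega_tree n (A j)) \<and>
        (\<forall>j. \<forall>x\<in>A j. \<forall>y\<in>A (Suc j). lex_less x y))"

lemma omega_tree_SucD:
  assumes "omega_tree (Suc n) S"
  shows "\<exists>A :: nat \<Rightarrow> (nat \<Rightarrow> nat) set. (\<forall>j. A j \<subseteq> S) \<and> (\<forall>j. omega_tree n (A j)) \<and>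
    (\<forall>j. \<forall>x\<in>A j. \<forall>y\<in>A (Suc j). lex_less x y)"
  using assms by (simp add: all_conj_distrib)

lemma omega_tree_SucI:
  assumes "\<And>j :: nat. A j \<subseteq> S" "\<And>j. omega_tree n (A j)"
    "\<And>j x y. x \<in> A j \<Longrightarrow> y \<in> A (Suc j) \<Longrightarrow> lex_less x y"
  shows "omega_tree (Suc n) S"
  unfolding omega_tree.simps by (intro exI[of _ A] conjI allI ballI) (fact assms)+

lemma omega_tree_mono:
  assumes "omega_tree n S" "S \<subseteq> S'"
  shows "omega_tree n S'"
proof (cases n)
  case 0
  with assms show ?thesis by auto
next
  case (Suc k)
  obtain A where A: "\<forall>j. A j \<subseteq> S" "\<forall>j. omega_tree k (A j)"
    "\<forall>j. \<forall>x\<in>A j. \<forall>y\<in>A (Suc j). lex_less x y"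
    using omega_tree_SucD[OF assms(1)[unfolded Suc]] by (elim exE conjE)
  have "A j \<subseteq> S'" for j using A(1) assms(2) by (meson subset_trans)
  then show ?thesis
    unfolding Suc by (intro omega_tree_SucI[of A]) (use A(2,3) in simp_all)
qed

lemma omega_tree_nonempty: "omega_tree n S \<Longrightarrow> S \<noteq> {}"
proof (induction n arbitrary: S)
  case (Suc n)
  obtain A where A: "\<forall>j. A j \<subseteq> S" "\<forall>j. omega_tree n (A j)"
    "\<forall>j. \<forall>x\<in>A j. \<forall>y\<in>A (Suc j). lex_less x y"
    using omega_tree_SucD[OF Suc.prems] by (elim exE conjE)
  have "A 0 \<noteq> {}" using A(2) Suc.IH by simp
  then show ?case using A(1) by (metis subset_empty)
qed simp

lemma omega_tree_decreasing: "omega_tree n S \<Longrightarrow> m \<le> n \<Longrightarrow> omega_tree m S"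
proof (induction n arbitrary: S m)
  case (Suc n)
  show ?case
  proof (cases m)
    case 0
    then show ?thesis using omega_tree_nonempty[OF Suc.prems(1)] by simp
  next
    case m: (Suc m')
    obtain A where A: "\<forall>j. A j \<subseteq> S" "\<forall>j. omega_tree n (A j)"
      "\<forall>j. \<forall>x\<in>A j. \<forall>y\<in>A (Suc j). lex_less x y"
      using omega_tree_SucD[OF Suc.prems(1)] by (elim exE conjE)
    have "m' \<le> n" using m Suc.prems(2) by simp
    then have "omega_tree (Suc m') S"
      by (intro omega_tree_SucI[of A]) (use A Suc.IH in simp_all)
    then show ?thesis using m by simp
  qed
qed simp

text \<open>The coefficients below \<open>n\<close> are free; in the induction step, fixing the one
  at \<open>n\<close> to \<open>j\<close> cuts out block number \<open>j\<close>.\<close>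

lemma omega_tree_cylinder: "omega_tree n {c. \<forall>k\<ge>n. c k = p k}"
proof (induction n arbitrary: p)
  case 0
  have "p \<in> {c. \<forall>k\<ge>0. c k = p k}" by simp
  then show ?case unfolding omega_tree.simps by blast
next
  case (Suc n)
  define A where "A j = {c. \<forall>k\<ge>n. c k = (p(n := j)) k}" for j
  show ?case
  proof (rule omega_tree_SucI)
    show "A j \<subseteq> {c. \<forall>k\<ge>Suc n. c k = p k}" for j
      unfolding A_def by (intro Collect_mono allI impI) simp
    show "omega_tree n (A j)" for j unfolding A_def by (rule Suc)
    show "lex_less x y" if "x \<in> A j" "y \<in> A (Suc j)" for x y j
      unfolding lex_less_def using that by (intro exI[of _ n]) (simp add: A_def)
  qed
qed

text \<open>Otherwise any two steps would raise \<open>s\<close> by at least one. Equality two steps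
  apart serves to squeeze the whole block in between.\<close>

lemma bounded_mono_seq_constant_step:
  fixes s :: "nat \<Rightarrow> nat"
  assumes "\<And>j. s j \<le> s (Suc j)" and "\<And>j. s j \<le> b"
  shows "\<exists>j. s j = s (Suc (Suc j))"
proof (rule ccontr)
  assume "\<not> ?thesis"
  then have *: "s j < s (Suc (Suc j))" for j
    using assms(1) by (metis le_neq_implies_less le_trans)
  have "j \<le> s (2 * j)" for j
  proof (induction j)
    case (Suc j)
    then show ?case using *[of "2 * j"] by simp
  qed simp
  from this[of "Suc b"] assms(2)[of "2 * Suc b"] show False by simp
qed

text \<open>Along the blocks, coefficient \<open>n\<close> of the images grows weakly and is at most
  \<open>b n\<close>, so it is constant on some block together with a point of either neighbour.
  That middle block has one level less and maps below the point of the next block, sharing with it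
  all coefficients from \<open>n\<close> on; so the induction applies.\<close>

lemma no_bounded_strict_mono_on_omega_tree:
  assumes "omega_tree n S"
    and "\<And>x y. x \<in> S \<Longrightarrow> y \<in> S \<Longrightarrow> lex_less x y \<Longrightarrow> lex_less (\<phi> x) (\<phi> y)"
    and "\<And>x. x \<in> S \<Longrightarrow> lex_less (\<phi> x) b"
    and "\<And>x k. x \<in> S \<Longrightarrow> n \<le> k \<Longrightarrow> \<phi> x k = b k"
  shows False
  using assms
proof (induction n arbitrary: S b)
  case 0
  then obtain x where "x \<in> S" by auto
  then have "\<phi> x = b" using 0(4) by auto
  with \<open>x \<in> S\<close> 0(3) show False using lex_less_irrefl by metis
next
  case (Suc n)
  obtain A where A: "\<forall>j. A j \<subseteq> S" "\<forall>j. omega_tree n (A j)"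
    and lt: "\<forall>j. \<forall>x\<in>A j. \<forall>y\<in>A (Suc j). lex_less x y"
    using omega_tree_SucD[OF Suc.prems(1)] by (elim exE conjE)
  have "\<exists>x. x \<in> A j" for j using omega_tree_nonempty A(2) by blast
  then obtain x where x: "\<And>j. x j \<in> A j" by metis
  have le: "\<phi> y n \<le> \<phi> z n" if "y \<in> A j" "z \<in> A (Suc j)" for j y z
  proof (rule lex_less_le_at[of "\<phi> y" "\<phi> z" n])
    show "lex_less (\<phi> y) (\<phi> z)" using that A(1) lt by (meson Suc.prems(2) subsetD)
    show "\<forall>k>n. \<phi> y k = \<phi> z k"
      using that A(1) Suc.prems(4) by (metis Suc_leI subsetD)
  qed
  have "\<phi> (x j) n \<le> b n" for j
  proof (rule lex_less_le_at[of "\<phi> (x j)" b n])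
    show "lex_less (\<phi> (x j)) b" using x A(1) Suc.prems(3) by blast
    show "\<forall>k>n. \<phi> (x j) k = b k" using x A(1) Suc.prems(4) by (metis Suc_leI subsetD)
  qed
  then obtain j where j: "\<phi> (x j) n = \<phi> (x (Suc (Suc j))) n"
    using bounded_mono_seq_constant_step[of "\<lambda>j. \<phi> (x j) n"] le x by blast
  show False
  proof (rule Suc.IH[OF A(2)[rule_format, of "Suc j"], of "\<phi> (x (Suc (Suc j)))"])
    fix y z assume "y \<in> A (Suc j)" "z \<in> A (Suc j)" "lex_less y z"
    then show "lex_less (\<phi> y) (\<phi> z)" using A(1) Suc.prems(2) by blast
  next
    fix y assume "y \<in> A (Suc j)"
    then show "lex_less (\<phi> y) (\<phi> (x (Suc (Suc j))))"
      using A(1) x lt by (meson Suc.prems(2) subsetD)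
  next
    fix y k assume y: "y \<in> A (Suc j)" and "n \<le> k"
    show "\<phi> y k = \<phi> (x (Suc (Suc j))) k"
    proof (cases "k = n")
      case True
      then show ?thesis using le[OF x y] le[OF y x] j by simp
    next
      case False
      then have "Suc n \<le> k" using \<open>n \<le> k\<close> by simp
      then show ?thesis using Suc.prems(4) A(1) y x by (metis subsetD)
    qed
  qed
qed

lemma no_strict_mono_on_omega_tree:
  assumes tree: "omega_tree (Suc r) S"
    and mono: "\<And>x y. x \<in> S \<Longrightarrow> y \<in> S \<Longrightarrow> lex_less x y \<Longrightarrow> lex_less (\<phi> x) (\<phi> y)"
    and zero: "\<And>x k. x \<in> S \<Longrightarrow> r < k \<Longrightarrow> \<phi> x k = 0"
    and bound: "\<And>x. x \<in> S \<Longrightarrow> \<phi> x r \<le> B"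
  shows False
proof (rule no_bounded_strict_mono_on_omega_tree[OF tree mono])
  \<comment> \<open>The normal form of \<omega>^r * (B + 1), which exceeds all values of
    \<open>\<phi>\<close>.\<close>
  let ?b = "(\<lambda>_. 0)(r := Suc B)"
  fix x assume x: "x \<in> S"
  show "lex_less (\<phi> x) ?b"
    unfolding lex_less_def by (rule exI[of _ r]) (use zero[OF x] bound[OF x] in auto)
  show "\<phi> x k = ?b k" if "Suc r \<le> k" for k
    using zero[OF x] that by simp
qed

section \<open>Skies of an ultrafilter\<close>

lemma ultrafilter_not_eventually:
  assumes "is_ultrafilter u" "\<not> eventually P u"
  shows "eventually (\<lambda>x. \<not> P x) u"
  using assms unfolding is_ultrafilter_def by (auto dest: spec[of _ "Collect P"])

lemma ultrafilter_happens:
  assumes "is_ultrafilter u" "eventually P u"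
  shows "\<exists>x. P x"
  using assms eventually_happens' unfolding is_ultrafilter_def by blast

text \<open>A preorder; its equivalence classes are the skies.\<close>

definition dominated :: "'a filter \<Rightarrow> ('a \<Rightarrow> nat) \<Rightarrow> ('a \<Rightarrow> nat) \<Rightarrow> bool" where
  "dominated u x y \<longleftrightarrow> (\<exists>h :: nat \<Rightarrow> nat. eventually (\<lambda>m. x m \<le> h (y m)) u)"

definition sky_less :: "'a filter \<Rightarrow> ('a \<Rightarrow> nat) \<Rightarrow> ('a \<Rightarrow> nat) \<Rightarrow> bool" where
  "sky_less u x y \<longleftrightarrow> (\<forall>h :: nat \<Rightarrow> nat. eventually (\<lambda>m. h (x m) < y m) u)"

lemma dominated_refl: "dominated u x x"
  unfolding dominated_def by (rule exI[of _ "\<lambda>n. n"]) simp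

lemma dominated_trans:
  assumes "dominated u x y" "dominated u y z"
  shows "dominated u x z"
proof -
  obtain h k where h: "eventually (\<lambda>m. x m \<le> h (y m)) u"
    and k: "eventually (\<lambda>m. y m \<le> k (z m)) u"
    using assms unfolding dominated_def by blast
  \<comment> \<open>\<open>h\<close> need not be monotone, so \<open>h (y m)\<close> is majorized by
    the maximum of \<open>h\<close> up to \<open>k (z m)\<close>.\<close>
  have "eventually (\<lambda>m. x m \<le> Max (h ` {..k (z m)})) u"
    using h k
  proof eventually_elim
    case (elim m)
    have "h (y m) \<le> Max (h ` {..k (z m)})" using elim(2) by (intro Max_ge) auto
    with elim(1) show ?case by simp
  qed
  then show ?thesis
    unfolding dominated_def by (intro exI[of _ "\<lambda>n. Max (h ` {..k n})"])
qed

text \<open>For each single \<open>h\<close>, an ultrafilter decides whether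
  \<open>y m \<le> h (x m)\<close> holds almost everywhere. Hence any two skies are
  comparable.\<close>

lemma not_dominated_iff_sky_less:
  assumes "is_ultrafilter u"
  shows "\<not> dominated u y x \<longleftrightarrow> sky_less u x y"
proof
  assume nd: "\<not> dominated u y x"
  show "sky_less u x y"
    unfolding sky_less_def
  proof
    fix h
    show "eventually (\<lambda>m. h (x m) < y m) u"
      using nd ultrafilter_not_eventually[OF assms, of "\<lambda>m. y m \<le> h (x m)"]
      unfolding dominated_def by (auto simp: not_le)
  qed
next
  assume sl: "sky_less u x y"
  show "\<not> dominated u y x"
  proof
    assume "dominated u y x"
    then obtain h where "eventually (\<lambda>m. y m \<le> h (x m)) u" unfolding dominated_def by blast
    moreover have "eventually (\<lambda>m. h (x m) < y m) u" using sl unfolding sky_less_def by blast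
    ultimately have "eventually (\<lambda>m. False) u" by eventually_elim simp
    then show False using ultrafilter_happens[OF assms] by blast
  qed
qed

lemma sky_less_imp_dominated: "sky_less u x y \<Longrightarrow> dominated u x y"
  unfolding sky_less_def dominated_def
  by (rule exI[of _ "\<lambda>n. n"], drule spec[of _ "\<lambda>n. n"]) (auto elim: eventually_mono)

lemma sky_less_trans:
  assumes "is_ultrafilter u" "sky_less u x y" "sky_less u y z"
  shows "sky_less u x z"
  using assms by (metis dominated_trans not_dominated_iff_sky_less sky_less_imp_dominated)

text \<open>Chains of every finite length give infinitely many skies. Colouring pairs of indices by
  whether the order of the skies agrees with that of the indices, Ramsey's theorem extracts a
  monotone subsequence.\<close>

lemma infinitely_many_skies_monotone_sequence:
  assumes u: "is_ultrafilter u"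
    and chains: "\<And>n. \<exists>s :: nat \<Rightarrow> 'a \<Rightarrow> nat. \<forall>i<n. sky_less u (s i) (s (Suc i))"
  obtains a :: "nat \<Rightarrow> 'a \<Rightarrow> nat"
  where "(\<forall>k. sky_less u (a k) (a (Suc k))) \<or> (\<forall>k. sky_less u (a (Suc k)) (a k))"
proof -
  \<comment> \<open>Two functions have the same \<open>cls\<close> exactly when they lie in the same
    sky.\<close>
  define cls where "cls x = {z. dominated u z x}" for x
  have cls_neq: "cls x \<noteq> cls y" if "sky_less u x y" for x y
    using that not_dominated_iff_sky_less[OF u] dominated_refl unfolding cls_def by blast
  have cls_neqD: "sky_less u x y \<or> sky_less u y x" if "cls x \<noteq> cls y" for x y
    using that not_dominated_iff_sky_less[OF u] dominated_trans unfolding cls_def by blast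
  have "infinite (range cls)"
  proof
    assume fin: "finite (range cls)"
    \<comment> \<open>A chain with as many steps as there are classes has one member too
      many.\<close>
    obtain s where s: "\<forall>i<card (range cls). sky_less u (s i) (s (Suc i))"
      using chains by blast
    let ?n = "card (range cls)"
    have less: "sky_less u (s i) (s j)" if "i < j" "j \<le> ?n" for i j
      using that
    proof (induction j)
      case (Suc j)
      then show ?case
        using s sky_less_trans[OF u, of "s i" "s j" "s (Suc j)"] by (cases "i = j") auto
    qed simp
    have "inj_on (cls \<circ> s) {..?n}"
      by (intro linorder_inj_onI) (auto dest!: less cls_neq)
    then have "card {..?n} \<le> ?n"
      using fin by (intro card_inj_on_le) auto
    then show False by simp
  qed
  then obtain C :: "nat \<Rightarrow> ('a \<Rightarrow> nat) set" where C: "inj C" "range C \<subseteq> range cls"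
    using infinite_countable_subset by blast
  then have "\<exists>d. C i = cls d" for i by blast
  then obtain d where d: "\<And>i. C i = cls (d i)" by metis
  have cmp: "sky_less u (d i) (d j) \<or> sky_less u (d j) (d i)" if "i \<noteq> j" for i j
    using cls_neqD C(1) d that by (metis injD)
  define col where "col P = (if sky_less u (d (Min P)) (d (Max P)) then 0 else 1 :: nat)" for P
  have "col {x, y} < 2" for x y by (simp add: col_def)
  then obtain Y t where Y: "infinite Y"
    and t: "\<And>x y. x \<in> Y \<Longrightarrow> y \<in> Y \<Longrightarrow> x \<noteq> y \<Longrightarrow> col {x, y} = t"
    using Ramsey2[of UNIV col 2] by auto
  let ?e = "enumerate Y"
  have e: "?e k \<in> Y" "?e k < ?e (Suc k)" for k
    using Y by (auto intro: enumerate_in_set enumerate_step)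
  have t_eq: "t = (if sky_less u (d (?e k)) (d (?e (Suc k))) then 0 else 1)" for k
    using t[OF e(1)[of k] e(1)[of "Suc k"]] e(2)[of k] by (simp add: col_def)
  show ?thesis
  proof (rule that[of "d \<circ> ?e"], cases "t = 0")
    case True
    then have "sky_less u (d (?e k)) (d (?e (Suc k)))" for k
      using t_eq[of k] by (auto split: if_splits)
    then show "(\<forall>k. sky_less u ((d \<circ> ?e) k) ((d \<circ> ?e) (Suc k))) \<or>
      (\<forall>k. sky_less u ((d \<circ> ?e) (Suc k)) ((d \<circ> ?e) k))" by simp
  next
    case False
    then have "sky_less u (d (?e (Suc k))) (d (?e k))" for k
      using t_eq[of k] cmp[of "?e k" "?e (Suc k)"] e(2)[of k] by (auto split: if_splits)
    then show "(\<forall>k. sky_less u ((d \<circ> ?e) k) ((d \<circ> ?e) (Suc k))) \<or>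
      (\<forall>k. sky_less u ((d \<circ> ?e) (Suc k)) ((d \<circ> ?e) k))" by simp
  qed
qed

section \<open>Merging levels\<close>

definition above :: "nat \<Rightarrow> (nat \<Rightarrow> nat) \<Rightarrow> nat \<Rightarrow> nat" where
  "above i c = (\<lambda>k. if i < k then c k else 0)"

text \<open>
  If the coefficient at \<open>i\<close> is at most \<open>h\<close> of the higher ones, then below a fixed prefix the
  pairs of coefficients at \<open>i + 1\<close> and \<open>i\<close> have order type at most \<open>\<omega>\<close>; the sum is the position
  of such a pair.
\<close>

definition merge_levels :: "nat \<Rightarrow> ((nat \<Rightarrow> nat) \<Rightarrow> nat) \<Rightarrow> (nat \<Rightarrow> nat) \<Rightarrow> nat \<Rightarrow> nat" where
  "merge_levels i h c = (\<lambda>k. if k < i then c k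
     else if k = i then c i + (\<Sum>j<c (Suc i). Suc (h ((above (Suc i) c)(Suc i := j))))
     else c (Suc k))"

lemma above_eq_fun_upd: "above i c = (above (Suc i) c)(Suc i := c (Suc i))"
  unfolding above_def by (auto simp: fun_eq_iff)

text \<open>The last summand, with index \<open>c (Suc i)\<close>, is
  \<open>Suc (h (above i c))\<close> and exceeds \<open>c i\<close>; the others are already part of
  the merged coefficient.\<close>

lemma merged_coeff_less:
  assumes "c i \<le> h (above i c)"
  shows "merge_levels i h c i < (\<Sum>j<Suc (c (Suc i)). Suc (h ((above (Suc i) c)(Suc i := j))))"
  using assms above_eq_fun_upd[of i c] unfolding merge_levels_def by simp

text \<open>A highest difference at or below \<open>i\<close> stays in place; one above
  \<open>i\<close> moves down by one index.\<close>

lemma merge_levels_strict_mono: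
  assumes "lex_less c d" and c: "c i \<le> h (above i c)"
  shows "lex_less (merge_levels i h c) (merge_levels i h d)"
proof -
  obtain p where p: "c p < d p" "\<And>k. p < k \<Longrightarrow> c k = d k"
    using assms(1) unfolding lex_less_def by blast
  let ?c = "merge_levels i h c" and ?d = "merge_levels i h d"
  have above: "above (Suc i) c = above (Suc i) d" if "p \<le> Suc i"
    unfolding above_def using that p(2) by (auto simp: fun_eq_iff)
  consider "p < i" | "p = i" | "p = Suc i" | "Suc i < p" by linarith
  then show ?thesis
  proof cases
    case 1
    then have "?c p < ?d p" "\<forall>k>p. ?c k = ?d k"
      using p above unfolding merge_levels_def by simp_all
    then show ?thesis unfolding lex_less_def by blast
  next
    case 2
    then have "?c p < ?d p" "\<forall>k>p. ?c k = ?d k"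
      using p above unfolding merge_levels_def by simp_all
    then show ?thesis unfolding lex_less_def by blast
  next
    case 3
    \<comment> \<open>Here \<open>d i\<close> may be below \<open>c i\<close>, but the merged
      position of \<open>c\<close> lies in the block of its own prefix, which ends no later than the
      block of \<open>d\<close> begins.\<close>
    have "?c i < (\<Sum>j<Suc (c (Suc i)). Suc (h ((above (Suc i) c)(Suc i := j))))"
      using c by (rule merged_coeff_less)
    also have "\<dots> \<le> (\<Sum>j<d (Suc i). Suc (h ((above (Suc i) c)(Suc i := j))))"
      by (rule sum_mono2) (use 3 p(1) in auto)
    also have "\<dots> \<le> ?d i"
      using 3 above unfolding merge_levels_def by simp
    finally have "?c i < ?d i" .
    moreover have "\<forall>k>i. ?c k = ?d k"
      using 3 p(2) unfolding merge_levels_def by simp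
    ultimately show ?thesis unfolding lex_less_def by blast
  next
    case 4
    then obtain q where q: "p = Suc q" by (cases p) auto
    with 4 p have "?c q < ?d q" "\<forall>k>q. ?c k = ?d k"
      unfolding merge_levels_def by simp_all
    then show ?thesis unfolding lex_less_def by blast
  qed
qed

text \<open>
  Allowing a bounded coefficient at \<open>r\<close>, instead of none, makes the merging step uniform: it also
  absorbs the topmost unbounded coefficient.
\<close>

lemma sky_chain_of_minimal_rank:
  fixes u :: "'a filter" and lt :: "'a \<Rightarrow> 'a \<Rightarrow> bool"
  defines "rank_le \<equiv> \<lambda>r. \<exists>U \<psi> B. eventually (\<lambda>m. m \<in> U) u \<and>
    (\<forall>m\<in>U. \<forall>m'\<in>U. lt m m' \<longrightarrow> lex_less (\<psi> m) (\<psi> m')) \<and>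
    (\<forall>m\<in>U. \<psi> m r \<le> (B :: nat) \<and> (\<forall>k>r. \<psi> m k = 0))"
  assumes u: "is_ultrafilter u" and r: "rank_le r" and min: "\<And>r'. r' < r \<Longrightarrow> \<not> rank_le r'"
  shows "\<exists>s :: nat \<Rightarrow> 'a \<Rightarrow> nat. \<forall>i<r. sky_less u (s i) (s (Suc i))"
proof -
  obtain U \<psi> B where U: "eventually (\<lambda>m. m \<in> U) u"
    and mono: "\<And>m m'. m \<in> U \<Longrightarrow> m' \<in> U \<Longrightarrow> lt m m' \<Longrightarrow> lex_less (\<psi> m) (\<psi> m')"
    and le_B: "\<And>m. m \<in> U \<Longrightarrow> \<psi> m r \<le> B"
    and zero: "\<And>m k. m \<in> U \<Longrightarrow> r < k \<Longrightarrow> \<psi> m k = 0"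
    using r unfolding rank_le_def by metis
  \<comment> \<open>If this fails, merging \<open>i\<close> into \<open>Suc i\<close> on a set of
    \<open>u\<close> gives rank \<open>r - 1\<close>, against minimality.\<close>
  have rise: "eventually (\<lambda>m. h (above i (\<psi> m)) < \<psi> m i) u" if "i < r" for i h
  proof (rule ccontr)
    assume "\<not> eventually (\<lambda>m. h (above i (\<psi> m)) < \<psi> m i) u"
    then have "eventually (\<lambda>m. \<not> h (above i (\<psi> m)) < \<psi> m i) u"
      by (rule ultrafilter_not_eventually[OF u])
    define V where "V = {m \<in> U. \<psi> m i \<le> h (above i (\<psi> m))}"
    have V: "eventually (\<lambda>m. m \<in> V) u"
      using U \<open>eventually (\<lambda>m. \<not> h (above i (\<psi> m)) < \<psi> m i) u\<close>
      by eventually_elim (simp add: V_def)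
    obtain r' where r': "r = Suc r'" using \<open>i < r\<close> by (cases r) auto
    let ?\<psi> = "\<lambda>m. merge_levels i h (\<psi> m)"
    \<comment> \<open>Bounds the merged coefficient in the topmost case \<open>Suc i = r\<close>,
      where everything above \<open>r\<close> is zero and the coefficient at \<open>r\<close> is at
      most \<open>B\<close>. For smaller \<open>i\<close> the coefficient at \<open>r\<close> moves
      to \<open>r'\<close> unchanged, and \<open>B\<close> bounds it.\<close>
    let ?B = "\<Sum>j<Suc B. Suc (h ((\<lambda>_. 0)(r := j)))"
    have mono': "lex_less (?\<psi> m) (?\<psi> m')" if "m \<in> V" "m' \<in> V" "lt m m'" for m m'
      using that mono[of m m'] by (intro merge_levels_strict_mono) (auto simp: V_def)
    have zero': "?\<psi> m k = 0" if "m \<in> V" "r' < k" for m k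
      using that \<open>i < r\<close> r' zero[of m "Suc k"] unfolding merge_levels_def V_def by simp
    have bound': "?\<psi> m r' \<le> B + ?B" if m: "m \<in> V" for m
    proof (cases "i = r'")
      case True
      have "above (Suc i) (\<psi> m) = (\<lambda>_. 0)"
        using zero[of m] m True r' unfolding above_def V_def by (auto simp: fun_eq_iff)
      then have "?\<psi> m r' < (\<Sum>j<Suc (\<psi> m r). Suc (h ((\<lambda>_. 0)(r := j))))"
        using merged_coeff_less[of "\<psi> m" i h] m True r' unfolding V_def by simp
      also have "\<dots> \<le> ?B"
        using le_B[of m] m by (intro sum_mono2) (auto simp: V_def)
      finally show ?thesis by simp
    next
      case False
      then have "?\<psi> m r' = \<psi> m r" using \<open>i < r\<close> r' unfolding merge_levels_def by simp
      then show ?thesis using le_B[of m] m unfolding V_def by simp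
    qed
    have "rank_le r'"
      unfolding rank_le_def
      by (intro exI[of _ V] exI[of _ ?\<psi>] exI[of _ "B + ?B"] conjI ballI allI impI
          V mono' zero' bound')
    then show False using min r' by simp
  qed
  \<comment> \<open>Skies compare single numbers, so the coefficients from \<open>i\<close> to
    \<open>r\<close> are represented by their sum, which depends on nothing else and is at least the
    coefficient at \<open>i\<close>.\<close>
  let ?s = "\<lambda>i m. \<Sum>k=i..r. \<psi> m k"
  have step: "sky_less u (?s (Suc i)) (?s i)" if "i < r" for i
    unfolding sky_less_def
  proof
    fix h
    have sum: "(\<Sum>k=Suc i..r. above i c k) = (\<Sum>k=Suc i..r. c k)" for c :: "nat \<Rightarrow> nat"
      by (rule sum.cong) (auto simp: above_def)
    have "eventually (\<lambda>m. h (\<Sum>k=Suc i..r. above i (\<psi> m) k) < \<psi> m i) u"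
      by (rule rise[OF that, of "\<lambda>c. h (\<Sum>k=Suc i..r. c k)"])
    then show "eventually (\<lambda>m. h (?s (Suc i) m) < ?s i m) u"
    proof eventually_elim
      case (elim m)
      have "?s i m = \<psi> m i + ?s (Suc i) m"
        using that by (simp add: sum.atLeast_Suc_atMost)
      with elim show ?case unfolding sum by simp
    qed
  qed
  \<comment> \<open>The skies rise as the index falls, hence the reversal.\<close>
  have "sky_less u (?s (r - i)) (?s (r - Suc i))" if "i < r" for i
    using step[of "r - Suc i"] that by (simp add: Suc_diff_Suc)
  then show ?thesis by (intro exI[of _ "\<lambda>i. ?s (r - i)"] allI impI)
qed

section \<open>Sets of the ultrafilter map onto trees\<close>

text \<open>The node at depth \<open>i\<close> on the branch of \<open>m\<close>. Its first
  component makes points with equal prefixes use the same index for their next coefficient.\<close>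

definition level_prefix :: "('a \<Rightarrow> nat \<Rightarrow> nat) \<Rightarrow> ('a \<Rightarrow> nat) \<Rightarrow> nat \<Rightarrow> 'a \<Rightarrow> nat \<times> (nat \<Rightarrow> nat)" where
  "level_prefix g \<kappa> i m = (\<kappa> m, \<lambda>k. if \<kappa> m - i \<le> k then g m k else 0)"

lemma level_prefix_Suc:
  assumes "level_prefix g \<kappa> (Suc i) m = level_prefix g \<kappa> (Suc i) m'"
  shows "level_prefix g \<kappa> i m = level_prefix g \<kappa> i m'" and "\<kappa> m = \<kappa> m'"
    and "g m (\<kappa> m - Suc i) = g m' (\<kappa> m - Suc i)"
proof -
  show \<kappa>: "\<kappa> m = \<kappa> m'" using assms unfolding level_prefix_def by simp
  have eq: "g m k = g m' k" if "\<kappa> m - Suc i \<le> k" for k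
    using assms that \<kappa> unfolding level_prefix_def by (auto dest: fun_cong[of _ _ k])
  then show "g m (\<kappa> m - Suc i) = g m' (\<kappa> m - Suc i)" by simp
  show "level_prefix g \<kappa> i m = level_prefix g \<kappa> i m'"
    unfolding level_prefix_def using \<kappa> eq by (auto simp: fun_eq_iff)
qed

text \<open>The tree grows from the leaves. The next coefficient outgrows any function of the
  prefix, so for almost every prefix it takes infinitely many values on points that already carry
  trees of one level less; these values number the blocks.\<close>

lemma omega_tree_of_rising_levels:
  assumes u: "is_ultrafilter u"
    and n: "eventually (\<lambda>m. n \<le> \<kappa> m) u"
    and rise: "\<And>i h. i < n \<Longrightarrow>
      eventually (\<lambda>m. h (level_prefix g \<kappa> i m) < g m (\<kappa> m - Suc i)) u"
    and U: "eventually (\<lambda>m. m \<in> U) u"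
  shows "omega_tree n (g ` U)"
proof -
  let ?Q = "level_prefix g \<kappa>"
  let ?F = "\<lambda>i m. {m' \<in> U. ?Q i m' = ?Q i m}"
  have "eventually (\<lambda>m. omega_tree k (g ` ?F (n - k) m)) u" if "k \<le> n" for k
    using that
  proof (induction k)
    case 0
    from U show ?case by eventually_elim auto
  next
    case (Suc k)
    define i where "i = n - Suc k"
    have i: "i < n" "n - k = Suc i" using Suc.prems unfolding i_def by simp_all
    define G where "G = {m. omega_tree k (g ` ?F (Suc i) m) \<and> n \<le> \<kappa> m}"
    have G: "eventually (\<lambda>m. m \<in> G) u"
      using Suc.IH Suc.prems n unfolding G_def i(2) by (simp add: eventually_conj)
    define X where "X q = (\<lambda>m. g m (\<kappa> m - Suc i)) ` {m \<in> G. ?Q i m = q}" for q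
    \<comment> \<open>Were \<open>X (?Q i m)\<close> finite, its maximum would bound the coefficient
      of \<open>m\<close> itself, which belongs to it. \<open>Max\<close> is meaningful in just that
      case, the one to be refuted.\<close>
    have "eventually (\<lambda>m. Max (X (?Q i m)) < g m (\<kappa> m - Suc i)) u"
      by (rule rise[OF i(1), of "\<lambda>q. Max (X q)"])
    then have "eventually (\<lambda>m. omega_tree (Suc k) (g ` ?F i m)) u"
      using G
    proof eventually_elim
      case (elim m)
      have "infinite (X (?Q i m))"
      proof
        assume "finite (X (?Q i m))"
        moreover have "g m (\<kappa> m - Suc i) \<in> X (?Q i m)" using elim(2) unfolding X_def by blast
        ultimately show False using elim(1) Max_ge by fastforce
      qed
      then have en: "enumerate (X (?Q i m)) j \<in> X (?Q i m)"
        "enumerate (X (?Q i m)) j < enumerate (X (?Q i m)) (Suc j)" for j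
        by (simp_all add: enumerate_in_set enumerate_step)
      have "\<exists>m'. m' \<in> G \<and> ?Q i m' = ?Q i m \<and>
          g m' (\<kappa> m' - Suc i) = enumerate (X (?Q i m)) j" for j
        using en(1)[of j] unfolding X_def by force
      then obtain y where y: "\<And>j. y j \<in> G" "\<And>j. ?Q i (y j) = ?Q i m"
        "\<And>j. g (y j) (\<kappa> (y j) - Suc i) = enumerate (X (?Q i m)) j"
        by metis
      show ?case
      proof (rule omega_tree_SucI[of "\<lambda>j. g ` ?F (Suc i) (y j)"])
        show "g ` ?F (Suc i) (y j) \<subseteq> g ` ?F i m" for j
        proof (rule image_mono, rule subsetI)
          fix z assume "z \<in> ?F (Suc i) (y j)"
          then show "z \<in> ?F i m" using level_prefix_Suc(1) y(2) by fastforce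
        qed
        show "omega_tree k (g ` ?F (Suc i) (y j))" for j using y(1) unfolding G_def by blast
        fix j a b assume "a \<in> g ` ?F (Suc i) (y j)" "b \<in> g ` ?F (Suc i) (y (Suc j))"
        then obtain z w where z: "a = g z" "?Q (Suc i) z = ?Q (Suc i) (y j)"
          and w: "b = g w" "?Q (Suc i) w = ?Q (Suc i) (y (Suc j))" by blast
        note lz = level_prefix_Suc[OF z(2)] and lw = level_prefix_Suc[OF w(2)]
        have Qzw: "?Q i z = ?Q i w" using lz(1) lw(1) y(2) by simp
        then have \<kappa>: "\<kappa> z = \<kappa> w" unfolding level_prefix_def by simp
        have "g z (\<kappa> z - Suc i) < g w (\<kappa> z - Suc i)"
          using lz(2,3) lw(2,3) \<kappa> y(3)[of j] y(3)[of "Suc j"] en(2)[of j] by simp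
        moreover have "g z l = g w l" if "\<kappa> z - Suc i < l" for l
        proof -
          have "n \<le> \<kappa> z" using lz(2) y(1)[of j] unfolding G_def by simp
          then have "\<kappa> z - i \<le> l" using that i(1) by simp
          then show ?thesis
            using Qzw \<kappa> unfolding level_prefix_def by (auto dest: fun_cong[of _ _ l])
        qed
        ultimately show "lex_less a b" unfolding z(1) w(1) lex_less_def by blast
      qed
    qed
    then show ?case unfolding i_def .
  qed
  from this[of n] obtain m where m: "omega_tree n (g ` ?F 0 m)"
    using ultrafilter_happens[OF u] by auto
  show ?thesis by (rule omega_tree_mono[OF m]) auto
qed

section \<open>Trees from a monotone sequence of skies\<close>

lemma finite_bounded_codes:
  fixes t :: nat
  shows "finite {(k, c). k \<le> t \<and> (\<forall>j. c j \<le> t) \<and> (\<forall>j>t. c j = 0)}" (is "finite ?S")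
proof (rule finite_subset)
  show "?S \<subseteq> {..t} \<times> {c. \<forall>j. (j \<in> {..t} \<longrightarrow> c j \<in> {..t}) \<and> (j \<notin> {..t} \<longrightarrow> c j = 0)}"
    by (auto simp: not_le)
  show "finite ({..t} \<times> {c. \<forall>j. (j \<in> {..t} \<longrightarrow> c j \<in> {..t}) \<and> (j \<notin> {..t} \<longrightarrow> c j = 0)})"
    by (intro finite_cartesian_product finite_set_of_finite_funs) simp_all
qed

text \<open>A prefix whose length, entries and support are bounded by \<open>y m\<close> ranges over
  a finite set determined by \<open>y m\<close>, so \<open>h\<close> of it is at most a function of
  \<open>y m\<close> alone.\<close>

lemma rise_of_sky_less:
  fixes h :: "nat \<times> (nat \<Rightarrow> nat) \<Rightarrow> nat"
  assumes "sky_less u y x"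
    and bound: "eventually (\<lambda>m. \<kappa> m \<le> y m \<and>
      (\<forall>k\<ge>\<kappa> m - i. g m k \<le> y m \<and> (y m < k \<longrightarrow> g m k = 0))) u"
  shows "eventually (\<lambda>m. h (level_prefix g \<kappa> i m) < x m) u"
proof -
  let ?S = "\<lambda>t. {(k, c). k \<le> t \<and> (\<forall>j. c j \<le> t) \<and> (\<forall>j>t. c j = 0)}"
  have "eventually (\<lambda>m. Max (h ` ?S (y m)) < x m) u"
    using assms(1) unfolding sky_less_def by (drule_tac x = "\<lambda>t. Max (h ` ?S t)" in spec)
  then show ?thesis using bound
  proof eventually_elim
    case (elim m)
    then have "level_prefix g \<kappa> i m \<in> ?S (y m)" unfolding level_prefix_def by auto
    then have "h (level_prefix g \<kappa> i m) \<le> Max (h ` ?S (y m))"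
      by (intro Max_ge finite_imageI finite_bounded_codes imageI)
    with elim(1) show ?case by simp
  qed
qed

lemma sky_less_eventually_le: "sky_less u x y \<Longrightarrow> eventually (\<lambda>m. x m \<le> y m) u"
  unfolding sky_less_def by (drule spec[of _ "\<lambda>t. t"]) (auto elim: eventually_mono)

lemma sky_less_eventually_ge: "sky_less u x y \<Longrightarrow> eventually (\<lambda>m. n \<le> y m) u"
  unfolding sky_less_def by (drule spec[of _ "\<lambda>_. n"]) (auto elim: eventually_mono)

lemma eventually_all_less:
  fixes n :: nat
  assumes "\<And>k. k < n \<Longrightarrow> eventually (P k) u"
  shows "eventually (\<lambda>m. \<forall>k<n. P k m) u"
proof -
  have "eventually (\<lambda>m. \<forall>k\<in>{..<n}. P k m) u"
    by (rule eventually_ball_finite) (use assms in simp_all)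
  then show ?thesis by eventually_elim simp
qed

lemma Greatest_bounded:
  fixes P :: "nat \<Rightarrow> bool"
  assumes "P 0" "\<And>n. P n \<Longrightarrow> n \<le> b"
  shows "P (Greatest P)" and "P n \<Longrightarrow> n \<le> Greatest P"
  using assms GreatestI_nat[of P 0 b] Greatest_le_nat[of P n b] by blast+

text \<open>
  The number of coefficients \<open>N m\<close> is capped by the values themselves, so that a prefix of the
  coefficient sequence, including its length, is bounded by a function of its last entry.
\<close>

lemma trees_of_increasing_skies:
  assumes u: "is_ultrafilter u" and a: "\<And>k. sky_less u (a k) (a (Suc k))"
  shows "\<exists>g. (\<forall>m. finite {k. g m k \<noteq> 0}) \<and>
    (\<forall>U n. eventually (\<lambda>m. m \<in> U) u \<longrightarrow> omega_tree n (g ` U))"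
proof -
  \<comment> \<open>Dropping \<open>a 0\<close> ensures that \<open>b 0\<close> exceeds every
    constant on a set of \<open>u\<close>.\<close>
  define b where "b k = a (Suc k)" for k
  have b: "sky_less u (b k) (b (Suc k))" for k unfolding b_def by (rule a)
  have b0: "eventually (\<lambda>m. n \<le> b 0 m) u" for n
    unfolding b_def using a by (rule sky_less_eventually_ge)
  define P where "P m N \<longleftrightarrow> N \<le> b 0 m \<and> (\<forall>k<N. b k m \<le> b (Suc k) m)" for m N
  define N where "N m = Greatest (P m)" for m
  \<comment> \<open>Reversed, since lower coefficients must lie in higher skies. The coefficients
    are \<open>b 1\<close> to \<open>b (N m)\<close>; \<open>b 0\<close> is kept back to bound the
    length \<open>N m\<close>, which is all that the prefix of depth 0 records.\<close>
  define g where "g m k = (if k < N m then b (N m - k) m else 0)" for m k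
  have P: "P m (N m)" "P m n \<Longrightarrow> n \<le> N m" for m n
    using Greatest_bounded[of "P m" "b 0 m"] unfolding N_def by (auto simp: P_def)
  have mono: "b j m \<le> b i m" if "j \<le> i" "i \<le> N m" for i j m
    using that
  proof (induction rule: dec_induct)
    case (step i)
    then have "b i m \<le> b (Suc i) m" using P(1)[of m] unfolding P_def by simp
    with step show ?case by simp
  qed simp
  have N_ge: "eventually (\<lambda>m. n \<le> N m) u" for n
  proof -
    have "eventually (\<lambda>m. \<forall>k<n. b k m \<le> b (Suc k) m) u"
      by (intro eventually_all_less) (rule sky_less_eventually_le[OF b])
    with b0[of n] show ?thesis
      by eventually_elim (auto intro: P(2) simp: P_def)
  qed
  have "omega_tree n (g ` U)" if U: "eventually (\<lambda>m. m \<in> U) u" for U n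
  proof (rule omega_tree_of_rising_levels[OF u N_ge _ U])
    fix i and h :: "nat \<times> (nat \<Rightarrow> nat) \<Rightarrow> nat"
    have "eventually (\<lambda>m. N m \<le> b i m \<and>
      (\<forall>k\<ge>N m - i. g m k \<le> b i m \<and> (b i m < k \<longrightarrow> g m k = 0))) u"
      using N_ge[of i]
    proof eventually_elim
      case (elim m)
      have N: "N m \<le> b i m" using P(1)[of m] mono[of 0 i m] elim unfolding P_def by simp
      moreover have "g m k \<le> b i m" if "N m - i \<le> k" for k
        using that mono[of "N m - k" i m] elim unfolding g_def by auto
      ultimately show ?case unfolding g_def by auto
    qed
    then have "eventually (\<lambda>m. h (level_prefix g N i m) < b (Suc i) m) u"
      by (rule rise_of_sky_less[OF b])
    with N_ge[of "Suc i"]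
    show "eventually (\<lambda>m. h (level_prefix g N i m) < g m (N m - Suc i)) u"
      by eventually_elim (simp add: g_def)
  qed
  moreover have "finite {k. g m k \<noteq> 0}" for m
    by (rule finite_support_if_eq_0_above[of "N m"]) (simp add: g_def)
  ultimately show ?thesis by blast
qed

text \<open>Coefficient \<open>k\<close> can be \<open>a k\<close> itself, as lower indices already
  have higher skies. The sequence is cut at \<open>N m\<close> for finite support; a tree of height
  \<open>n\<close> branches only at coefficients below \<open>n\<close>, whence the constant
  \<open>\<kappa>\<close>.\<close>

lemma trees_of_decreasing_skies:
  assumes u: "is_ultrafilter u" and a: "\<And>k. sky_less u (a (Suc k)) (a k)"
  shows "\<exists>g. (\<forall>m. finite {k. g m k \<noteq> 0}) \<and>
    (\<forall>U n. eventually (\<lambda>m. m \<in> U) u \<longrightarrow> omega_tree n (g ` U))"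
proof -
  \<comment> \<open>The cap \<open>N \<le> a k m\<close> bounds the support by each coefficient in
    use, as \<open>rise_of_sky_less\<close> demands.\<close>
  define P where "P m N \<longleftrightarrow> (\<forall>k<N. N \<le> a k m \<and> (Suc k < N \<longrightarrow> a (Suc k) m \<le> a k m))" for m N
  define N where "N m = Greatest (P m)" for m
  define g where "g m k = (if k < N m then a k m else 0)" for m k
  have "n \<le> a 0 m" if "P m n" for m n using that unfolding P_def by (cases n) auto
  then have P: "P m (N m)" "P m n \<Longrightarrow> n \<le> N m" for m n
    using Greatest_bounded[of "P m" "a 0 m"] unfolding N_def by (auto simp: P_def)
  have mono: "a j m \<le> a i m" if "i \<le> j" "j < N m" for i j m
    using that
  proof (induction rule: dec_induct)
    case (step j)
    then have "a (Suc j) m \<le> a j m" using P(1)[of m] unfolding P_def by simp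
    with step show ?case by simp
  qed simp
  have N_ge: "eventually (\<lambda>m. n \<le> N m) u" for n
  proof -
    have "eventually (\<lambda>m. \<forall>k<n. n \<le> a k m \<and> a (Suc k) m \<le> a k m) u"
      by (intro eventually_all_less eventually_conj)
        (rule sky_less_eventually_ge[OF a], rule sky_less_eventually_le[OF a])
    then show ?thesis
      by eventually_elim (auto intro: P(2) simp: P_def)
  qed
  have "omega_tree n (g ` U)" if U: "eventually (\<lambda>m. m \<in> U) u" for U n
  proof (rule omega_tree_of_rising_levels[OF u _ _ U, where \<kappa> = "\<lambda>_. n"])
    fix i and h :: "nat \<times> (nat \<Rightarrow> nat) \<Rightarrow> nat" assume "i < n"
    define k where "k = n - Suc i"
    have k: "k < n" "n - i = Suc k" using \<open>i < n\<close> unfolding k_def by simp_all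
    have "eventually (\<lambda>m. n \<le> a (Suc k) m \<and>
      (\<forall>j\<ge>n - i. g m j \<le> a (Suc k) m \<and> (a (Suc k) m < j \<longrightarrow> g m j = 0))) u"
      \<comment> \<open>\<open>Suc n\<close> rather than \<open>n\<close>: for \<open>i = 0\<close>
        the bounding function is \<open>a n\<close>, which must still be among the
        coefficients.\<close>
      using N_ge[of "Suc n"]
    proof eventually_elim
      case (elim m)
      then have N: "N m \<le> a (Suc k) m" using P(1)[of m] k(1) unfolding P_def by simp
      moreover have "g m j \<le> a (Suc k) m" if "n - i \<le> j" for j
        using that mono[of "Suc k" j m] k(2) unfolding g_def by auto
      ultimately show ?case using elim unfolding g_def by auto
    qed
    then have "eventually (\<lambda>m. h (level_prefix g (\<lambda>_. n) i m) < a k m) u"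
      by (rule rise_of_sky_less[OF a])
    with N_ge[of n] have "eventually (\<lambda>m. h (level_prefix g (\<lambda>_. n) i m) < g m k) u"
    proof eventually_elim
      case (elim m)
      then have "g m k = a k m" using k(1) unfolding g_def by simp
      with elim show ?case by simp
    qed
    then show "eventually (\<lambda>m. h (level_prefix g (\<lambda>_. n) i m) < g m (n - Suc i)) u"
      unfolding k_def .
  qed simp
  moreover have "finite {k. g m k \<noteq> 0}" for m
    by (rule finite_support_if_eq_0_above[of "N m"]) (simp add: g_def)
  ultimately show ?thesis by blast
qed

section \<open>Order types\<close>

lemma embed_strict_mono:
  assumes "Well_order r" "embed r r' f" "(x, y) \<in> r" "x \<noteq> y"
  shows "(f x, f y) \<in> r'" and "f x \<noteq> f y"
proof -
  show "(f x, f y) \<in> r'"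
    using embed_compat[OF assms(2)] assms(3) unfolding compat_def by blast
  show "f x \<noteq> f y"
    using embed_inj_on[OF assms(1,2)] assms(3,4) unfolding inj_on_def Field_def by blast
qed

lemma lex_less_if_mem_omega_omega: "(c, d) \<in> omega_omega \<Longrightarrow> c \<noteq> d \<Longrightarrow> lex_less c d"
  unfolding mem_omega_omega_iff by blast

text \<open>\<open>r\<close> is isomorphic to the segment below some \<open>d\<close>. As
  \<open>d\<close> has finite support, everything below it vanishes from some \<open>n\<close> on;
  so \<open>r\<close> maps into \<omega>^n.\<close>

lemma strict_map_of_ordLess_omega_omega:
  assumes "r <o omega_omega"
  shows "\<exists>\<phi> n. (\<forall>x y. (x, y) \<in> r \<longrightarrow> x \<noteq> y \<longrightarrow> lex_less (\<phi> x) (\<phi> y)) \<and>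
    (\<forall>x\<in>Field r. \<forall>k\<ge>n. \<phi> x k = 0)"
proof -
  have r: "Well_order r" using assms unfolding ordLess_def by blast
  obtain d where d: "d \<in> Field omega_omega" "r =o Restr omega_omega (underS omega_omega d)"
    using assms unfolding ordLess_iff_ordIso_Restr[OF Well_order_omega_omega r] by (elim bexE)
  then obtain \<phi> where \<phi>: "embed r (Restr omega_omega (underS omega_omega d)) \<phi>"
    unfolding ordIso_def iso_def by blast
  have "finite {k. d k \<noteq> 0}" using d(1) unfolding Field_omega_omega by simp
  then obtain n where "\<forall>k\<in>{k. d k \<noteq> 0}. k < n"
    unfolding finite_nat_set_iff_bounded ..
  then have n: "d k = 0" if "n \<le> k" for k using that by (auto dest: leD)
  have mono: "lex_less (\<phi> x) (\<phi> y)" if "(x, y) \<in> r" "x \<noteq> y" for x y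
    using embed_strict_mono[OF r \<phi> that] lex_less_if_mem_omega_omega by blast
  have zero: "\<phi> x k = 0" if x: "x \<in> Field r" and k: "n \<le> k" for x k
  proof -
    have "\<phi> x \<in> Field (Restr omega_omega (underS omega_omega d))"
      using imageI[OF x] by (rule subsetD[OF embed_Field[OF \<phi>]])
    then have "\<phi> x \<in> underS omega_omega d" by (rule subsetD[OF Field_Restr_subset])
    then have "(\<phi> x, d) \<in> omega_omega" "\<phi> x \<noteq> d" unfolding underS_def by blast+
    then have "lex_less (\<phi> x) d" by (rule lex_less_if_mem_omega_omega)
    then obtain p where p: "\<phi> x p < d p" "\<forall>k>p. \<phi> x k = d k" unfolding lex_less_def by blast
    then have "p < n" using n[of p] by (cases "p < n") simp_all
    then have "\<phi> x k = d k" using p(2) k by simp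
    moreover have "d k = 0" using k by (rule n)
    ultimately show ?thesis by simp
  qed
  show ?thesis by (intro exI[of _ \<phi>] exI[of _ n] conjI allI impI ballI mono zero)
qed

lemma countable_Field_omega_omega: "countable (Field omega_omega)"
proof (rule countable_subset)
  let ?f = "\<lambda>xs :: nat list. \<lambda>k. if k < length xs then xs ! k else 0"
  show "Field omega_omega \<subseteq> range ?f"
  proof
    fix c assume "c \<in> Field omega_omega"
    then obtain n where "\<forall>k\<in>{k. c k \<noteq> 0}. k < n"
      unfolding Field_omega_omega mem_Collect_eq finite_nat_set_iff_bounded ..
    then have n: "k < n" if "c k \<noteq> 0" for k using that by simp
    have "c = ?f (map c [0..<n])" using n by (auto simp: fun_eq_iff)
    then show "c \<in> range ?f" by blast
  qed
qed simp

text \<open>Otherwise \<open>omega1\<close> would be shorter than a countable well-order, hence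
  countable.\<close>

lemma omega_omega_ordLeq_omega1: "omega_omega \<le>o omega1"
proof (rule ccontr)
  assume "\<not> omega_omega \<le>o omega1"
  then have "omega1 <o omega_omega"
    unfolding not_ordLeq_iff_ordLess[OF Well_order_omega1 Well_order_omega_omega] .
  then have "omega1 \<le>o omega_omega" by (rule ordLess_imp_ordLeq)
  then have "|Field omega1| \<le>o |Field omega_omega|" by (rule card_of_mono2)
  moreover have "|Field omega_omega| \<le>o natLeq"
    using countable_Field_omega_omega unfolding countable_card_le_natLeq .
  ultimately have le: "|Field omega1| \<le>o natLeq" by (rule ordLeq_transitive)
  have "omega1 =o |Field omega1|"
    unfolding omega1_def
    by (rule ordIso_symmetric[OF card_of_Field_ordIso[OF cardSuc_Card_order[OF natLeq_Card_order]]])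
  then have "omega1 \<le>o natLeq" using le by (rule ordIso_ordLeq_trans)
  moreover have "natLeq <o omega1"
    unfolding omega1_def by (rule cardSuc_greater[OF natLeq_Card_order])
  ultimately show False using not_ordLess_ordLeq[of natLeq omega1] by simp
qed

text \<open>The ordinal \<omega>^n, realized by the functions that vanish from \<open>n\<close> on.
  It has the type of \<open>omega_omega\<close>, so it can be taken for \<open>\<beta>\<close> in
  the theorem.\<close>

definition omega_pow :: "nat \<Rightarrow> (nat \<Rightarrow> nat) rel" where
  "omega_pow n = Restr omega_omega (underS omega_omega ((\<lambda>_. 0)(n := 1)))"

lemma omega_pow_ordLess: "omega_pow n <o omega_omega"
proof -
  have "(\<lambda>_. 0)(n := 1 :: nat) \<in> Field omega_omega"
    unfolding Field_omega_omega by simp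
  then show ?thesis
    unfolding omega_pow_def by (intro underS_Restr_ordLess[OF Well_order_omega_omega]) blast
qed

lemma mem_omega_pow:
  assumes "\<forall>k\<ge>n. c k = 0" "\<forall>k\<ge>n. d k = 0" "c = d \<or> lex_less c d"
  shows "(c, d) \<in> omega_pow n"
proof -
  have *: "x \<in> underS omega_omega ((\<lambda>_. 0)(n := 1))" if "\<forall>k\<ge>n. x k = 0" for x
  proof -
    have "lex_less x ((\<lambda>_. 0)(n := 1))"
      unfolding lex_less_def by (rule exI[of _ n]) (use that in simp)
    moreover have "x \<noteq> (\<lambda>_. 0)(n := 1)" using that by (metis fun_upd_same le_refl zero_neq_one)
    ultimately show ?thesis
      using finite_support_if_eq_0_above[OF that]
      unfolding underS_def mem_omega_omega_iff by simp
  qed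
  show ?thesis
    using *[OF assms(1)] *[OF assms(2)] assms(3)
      finite_support_if_eq_0_above[OF assms(1)] finite_support_if_eq_0_above[OF assms(2)]
    unfolding omega_pow_def by (simp add: mem_omega_omega_iff)
qed

text \<open>The \<omega>^\<omega> property bounds the rank of a witness \<open>f\<close> on some set
  of \<open>u\<close>. The minimal rank is at least \<open>n\<close>, since the image f[V] of every
  set \<open>V\<close> of \<open>u\<close> contains a copy of \<omega>^n.\<close>

lemma sky_chains_of_not_J_ultrafilter:
  assumes J: "J_ultrafilter omega_omega u" and not_J: "\<not> J_ultrafilter (omega_pow n) u"
  shows "\<exists>s :: nat \<Rightarrow> nat \<Rightarrow> nat. \<forall>i<n. sky_less u (s i) (s (Suc i))"
proof -
  have u: "is_ultrafilter u" using J unfolding J_ultrafilter_def by blast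
  obtain f where f: "range f \<subseteq> Field omega1"
    and large: "\<And>U. eventually (\<lambda>m. m \<in> U) u \<Longrightarrow> \<not> Restr omega1 (f ` U) <o omega_pow n"
    using not_J u unfolding J_ultrafilter_def by blast
  define lt where "lt m m' \<longleftrightarrow> (f m, f m') \<in> omega1 \<and> f m \<noteq> f m'" for m m'
  \<comment> \<open>The points of some set of \<open>u\<close>, compared by their values under
    \<open>f\<close>, map strictly below \<omega>^r * (B + 1).\<close>
  define rank_le where "rank_le r \<longleftrightarrow> (\<exists>U \<psi> B. eventually (\<lambda>m. m \<in> U) u \<and>
    (\<forall>m\<in>U. \<forall>m'\<in>U. lt m m' \<longrightarrow> lex_less (\<psi> m) (\<psi> m')) \<and>
    (\<forall>m\<in>U. \<psi> m r \<le> (B :: nat) \<and> (\<forall>k>r. \<psi> m k = 0)))" for r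
  obtain U where U: "eventually (\<lambda>m. m \<in> U) u" "Restr omega1 (f ` U) <o omega_omega"
    using J f unfolding J_ultrafilter_def by blast
  obtain \<phi> n0 where \<phi>:
    "\<forall>x y. (x, y) \<in> Restr omega1 (f ` U) \<longrightarrow> x \<noteq> y \<longrightarrow> lex_less (\<phi> x) (\<phi> y)"
    "\<forall>x\<in>Field (Restr omega1 (f ` U)). \<forall>k\<ge>n0. \<phi> x k = 0"
    using strict_map_of_ordLess_omega_omega[OF U(2)] by (elim exE conjE)
  have "Refl omega1"
    using Well_order_omega1 unfolding order_on_defs by blast
  then have Field: "Field (Restr omega1 (f ` V)) = f ` V" for V
    using f by (intro Refl_Field_Restr2) auto
  have "rank_le n0"
    unfolding rank_le_def
  proof (intro exI conjI ballI impI allI)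
    show "eventually (\<lambda>m. m \<in> U) u" by (rule U(1))
    fix m assume m: "m \<in> U"
    then have zero: "\<phi> (f m) k = 0" if "n0 \<le> k" for k using \<phi>(2) Field that by blast
    then show "\<phi> (f m) n0 \<le> 0" by simp
    show "\<phi> (f m) k = 0" if "n0 < k" for k using zero that by simp
    show "lex_less (\<phi> (f m)) (\<phi> (f m'))" if "m' \<in> U" "lt m m'" for m'
      using \<phi>(1) m that unfolding lt_def by blast
  qed
  define r where "r = (LEAST r. rank_le r)"
  have r: "rank_le r" unfolding r_def by (rule LeastI) fact
  have min: "\<not> rank_le r'" if "r' < r" for r'
    using that unfolding r_def by (rule not_less_Least)
  have "n \<le> r"
  proof (rule ccontr)
    assume "\<not> n \<le> r"
    obtain V \<psi> B where V: "eventually (\<lambda>m. m \<in> V) u"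
      and mono: "\<forall>m\<in>V. \<forall>m'\<in>V. lt m m' \<longrightarrow> lex_less (\<psi> m) (\<psi> m')"
      and bounds: "\<forall>m\<in>V. \<psi> m r \<le> B \<and> (\<forall>k>r. \<psi> m k = 0)"
      using r unfolding rank_le_def by (elim exE conjE)
    have pow: "Well_order (omega_pow n)"
      unfolding omega_pow_def by (rule Well_order_Restr[OF Well_order_omega_omega])
    have "omega_pow n \<le>o Restr omega1 (f ` V)"
      using large[OF V] not_ordLess_iff_ordLeq[OF pow Well_order_Restr[OF Well_order_omega1]]
      by blast
    then obtain e where e: "embed (omega_pow n) (Restr omega1 (f ` V)) e"
      unfolding ordLeq_def by blast
    let ?S = "{c :: nat \<Rightarrow> nat. \<forall>k\<ge>n. c k = 0}"
    have e_strict: "(e x, e y) \<in> Restr omega1 (f ` V)" "e x \<noteq> e y"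
      if "x \<in> ?S" "y \<in> ?S" "lex_less x y" for x y
    proof -
      have "(x, y) \<in> omega_pow n" "x \<noteq> y"
        using that mem_omega_pow lex_less_irrefl by auto
      then show "(e x, e y) \<in> Restr omega1 (f ` V)" "e x \<noteq> e y"
        by (rule embed_strict_mono[OF pow e])+
    qed
    have e_mem: "e x \<in> f ` V" if x: "x \<in> ?S" for x
    proof -
      have "x \<in> Field (omega_pow n)"
        using mem_omega_pow[of n x x] x unfolding Field_def by blast
      then show ?thesis using embed_Field[OF e] Field by blast
    qed
    \<comment> \<open>A choice of preimages under \<open>f\<close>, carrying the copy of \<omega>^n
      into \<open>V\<close>.\<close>
    define p where "p x = inv_into V f (e x)" for x
    have p: "p x \<in> V \<and> f (p x) = e x" if "x \<in> ?S" for x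
      unfolding p_def using e_mem[OF that] by (simp add: inv_into_into f_inv_into_f)
    \<comment> \<open>\<open>\<psi> \<circ> p\<close> would map a tree of height
      \<open>Suc r \<le> n\<close> strictly below \<omega>^r * (B + 1).\<close>
    show False
    proof (rule no_strict_mono_on_omega_tree[where \<phi> = "\<psi> \<circ> p"])
      show "omega_tree (Suc r) ?S"
        by (rule omega_tree_decreasing[OF omega_tree_cylinder]) (use \<open>\<not> n \<le> r\<close> in simp)
    next
      fix x y assume xy: "x \<in> ?S" "y \<in> ?S" "lex_less x y"
      then have "lt (p x) (p y)" using e_strict[OF xy] p unfolding lt_def by auto
      then show "lex_less ((\<psi> \<circ> p) x) ((\<psi> \<circ> p) y)" using mono p xy by simp
    qed (use p bounds in auto)
  qed
  have "\<exists>s :: nat \<Rightarrow> nat \<Rightarrow> nat. \<forall>i<r. sky_less u (s i) (s (Suc i))"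
    using u r min unfolding rank_le_def by (rule sky_chain_of_minimal_rank)
  with \<open>n \<le> r\<close> show ?thesis by (meson less_le_trans)
qed

theorem theorem3p9:
  shows "\<not> (\<exists>u :: nat filter.
           J_ultrafilter omega_omega u \<and>
           (\<forall>\<beta> :: (nat \<Rightarrow> nat) rel. \<beta> <o omega_omega \<longrightarrow> \<not> J_ultrafilter \<beta> u))"
proof
  assume "\<exists>u :: nat filter.
           J_ultrafilter omega_omega u \<and>
           (\<forall>\<beta> :: (nat \<Rightarrow> nat) rel. \<beta> <o omega_omega \<longrightarrow> \<not> J_ultrafilter \<beta> u)"
  then obtain u :: "nat filter" where J: "J_ultrafilter omega_omega u"
    and not_J: "\<And>\<beta> :: (nat \<Rightarrow> nat) rel. \<beta> <o omega_omega \<Longrightarrow> \<not> J_ultrafilter \<beta> u"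
    by blast
  have u: "is_ultrafilter u" using J unfolding J_ultrafilter_def by blast
  obtain a :: "nat \<Rightarrow> nat \<Rightarrow> nat"
    where "(\<forall>k. sky_less u (a k) (a (Suc k))) \<or> (\<forall>k. sky_less u (a (Suc k)) (a k))"
    using infinitely_many_skies_monotone_sequence[OF u
        sky_chains_of_not_J_ultrafilter[OF J not_J[OF omega_pow_ordLess]]] .
  then obtain g where g: "\<And>m. finite {k. g m k \<noteq> 0}"
    "\<And>U n. eventually (\<lambda>m. m \<in> U) u \<Longrightarrow> omega_tree n (g ` U)"
    using trees_of_increasing_skies[OF u] trees_of_decreasing_skies[OF u] by metis
  \<comment> \<open>\<open>e\<close> moves the values of \<open>g\<close> into
    \<open>omega1\<close>, where the \<omega>^\<omega> property applies.\<close>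
  obtain e where e: "embed omega_omega omega1 e"
    using omega_omega_ordLeq_omega1 unfolding ordLeq_def by blast
  have "range (e \<circ> g) \<subseteq> Field omega1"
    using embed_Field[OF e] g(1) unfolding Field_omega_omega by auto
  then obtain U where U: "eventually (\<lambda>m. m \<in> U) u"
    "Restr omega1 ((e \<circ> g) ` U) <o omega_omega"
    using J unfolding J_ultrafilter_def by blast
  obtain \<phi> n where \<phi>:
    "\<forall>x y. (x, y) \<in> Restr omega1 ((e \<circ> g) ` U) \<longrightarrow> x \<noteq> y \<longrightarrow> lex_less (\<phi> x) (\<phi> y)"
    "\<forall>x\<in>Field (Restr omega1 ((e \<circ> g) ` U)). \<forall>k\<ge>n. \<phi> x k = 0"
    using strict_map_of_ordLess_omega_omega[OF U(2)] by (elim exE conjE)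
  have Field: "Field (Restr omega1 ((e \<circ> g) ` U)) = (e \<circ> g) ` U"
    using Well_order_omega1 \<open>range (e \<circ> g) \<subseteq> Field omega1\<close>
    by (intro Refl_Field_Restr2) (auto simp: order_on_defs)
  \<comment> \<open>g[U] contains trees of all heights, but a set of type below \<omega>^\<omega>
    maps strictly into some \<omega>^n, which excludes height \<open>Suc n\<close>.\<close>
  show False
  proof (rule no_strict_mono_on_omega_tree[OF g(2)[OF U(1)], where \<phi> = "\<phi> \<circ> e"])
    fix x y assume xy: "x \<in> g ` U" "y \<in> g ` U" "lex_less x y"
    then have "(x, y) \<in> omega_omega" "x \<noteq> y"
      using g(1) lex_less_irrefl by (auto simp: mem_omega_omega_iff)
    then have "(e x, e y) \<in> omega1" "e x \<noteq> e y"
      using embed_strict_mono[OF Well_order_omega_omega e] by blast+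
    with xy \<phi>(1) show "lex_less ((\<phi> \<circ> e) x) ((\<phi> \<circ> e) y)" by auto
  next
    fix x k assume "x \<in> g ` U" "n < k"
    then show "(\<phi> \<circ> e) x k = 0" using \<phi>(2) Field by auto
  next
    fix x assume "x \<in> g ` U"
    then show "(\<phi> \<circ> e) x n \<le> 0" using \<phi>(2) Field by auto
  qed
qed

end
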